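(* Let $W$ be an infinite dihedral group with distinguished generators $S=\{s_1,s_2\}$. For $a\neq b$ in $S$ and $j>0$ let $\langle j,a,b]=\ldots ab$ denote the alternating product of $j$ factors $a,b$ whose last factor is $b$, let $(c_w)_{w\in W}$ be the Kazhdan-Lusztig basis of the Hecke algebra of $W$, and write $C_j=c_{\langle j,s_1,s_2]}$. Let $k>0$, let $s$ be the first factor of $\langle k,s_1,s_2]$ (i.e. $s=s_1$ if $k$ is even, $s=s_2$ if $k$ is odd), and let $t$ be the other element of $S$. Then, for every integer $i>0$, $$c_{\langle i,s,t]}\cdot C_k=\begin{cases}C_{k-i}+2C_{k-i+2}+\cdots+2C_{k+i-2}+C_{k+i}&(0<i<k)\\ 2C_2+2C_4+\cdots+2C_{2k-2}+C_{2k}&(i=k)\\ C_{i-k}+2C_{i-k+2}+\cdots+2C_{i+k-2}+C_{i+k}&(i>k)\end{cases}$$ (where for $k=1$ the entry for $i=k$ is interpreted as $C_2$), and $$c_{\langle i,t,s]}\cdot C_k=\begin{cases}(v+v^{-1})C_{k-i+1}+(v+v^{-1})C_{k-i+3}+\cdots+(v+v^{-1})C_{k+i-1}&(0<i\leq k)\\ (v+v^{-1})C_{i-k+1}+(v+v^{-1})C_{i-k+3}+\cdots+(v+v^{-1})C_{i+k-1}&(i\geq k)\end{cases}$$ In all these sums the indices increase in steps of $2$; in the first set of formulas the first and last terms have coefficient $1$ and all intermediate ones coefficient $2$ (except that for $i=k$ all terms but the last have coefficient $2$). The same formulas hold with the roles of $s_1$ and $s_2$ exchanged, i.e. with $c_{\langle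 j,s_1,s_2]}$ replaced by $c_{\langle j,s_2,s_1]}$ throughout and $s$ the first factor of $\langle k,s_2,s_1]$.
   Context: For a Coxeter group $(W,S)$ with Bruhat order $\leq$, let $A=\mathbf{Z}[v,v^{-1}]$ with $v$ an indeterminate. The Hecke algebra $\mathcal{H}$ is the free $A$-module with basis $(t_y)_{y\in W}$, with the unique associative $A$-algebra structure such that, for $s\in S$ and $y\in W$, $$t_s t_y=\begin{cases}t_{sy}&\text{if } sy>y,\\ (v-v^{-1})t_y+t_{sy}&\text{if } sy<y.\end{cases}$$ There is a unique ring involution $i$ of $\mathcal{H}$ with $i(v)=v^{-1}$ and $i(t_y)=t_{y^{-1}}^{-1}$ for all $y\in W$. The Kazhdan-Lusztig basis of $\mathcal{H}$ is the unique family $(c_y)_{y\in W}$ such that $i(c_y)=c_y$ and $c_y=t_y+\sum_{x<y}p_{x,y}t_x$ with $p_{x,y}\in v^{-1}\mathbf{Z}[v^{-1}]$. (The involution $i$ is unrelated to the integer $i$ in the claim.) *)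

theory Defs
  imports Complex_Main "HOL-Algebra.Generated_Groups" "HOL-Library.Poly_Mapping"
begin

text \<open>
  The ring of integral Laurent polynomials is the group ring of the integers:
  finitely supported maps from exponents to coefficients with the convolution product
  of \<^theory>\<open>HOL-Library.Poly_Mapping\<close>.
\<close>

type_synonym laurent = "int \<Rightarrow>\<^sub>0 int"

definition v :: laurent where
  "v = Poly_Mapping.single 1 1"

definition v_inv :: laurent where
  "v_inv = Poly_Mapping.single (- 1) 1"

text \<open>The subset $v^{-1} {\bf Z}[v^{-1}]$: only negative exponents occur.\<close>

definition negative_laurent :: "laurent set" where
  "negative_laurent = {p. Poly_Mapping.keys p \<subseteq> {..<0}}"


definition word_length :: "('w, 'm) monoid_scheme \<Rightarrow> 'w set \<Rightarrow> 'w \<Rightarrow> nat" where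
  "word_length W S w =
     (LEAST n. \<exists>ws. set ws \<subseteq> S \<and> length ws = n \<and> foldr (\<otimes>\<^bsub>W\<^esub>) ws \<one>\<^bsub>W\<^esub> = w)"

definition reflections :: "('w, 'm) monoid_scheme \<Rightarrow> 'w set \<Rightarrow> 'w set" where
  "reflections W S = {w \<otimes>\<^bsub>W\<^esub> s \<otimes>\<^bsub>W\<^esub> inv\<^bsub>W\<^esub> w | w s. w \<in> carrier W \<and> s \<in> S}"

definition bruhat_step :: "('w, 'm) monoid_scheme \<Rightarrow> 'w set \<Rightarrow> 'w \<Rightarrow> 'w \<Rightarrow> bool" where
  "bruhat_step W S x y \<longleftrightarrow>
     x \<in> carrier W \<and> (\<exists>r \<in> reflections W S. y = x \<otimes>\<^bsub>W\<^esub> r) \<and> word_length W S x < word_length W S y"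

definition bruhat_le :: "('w, 'm) monoid_scheme \<Rightarrow> 'w set \<Rightarrow> 'w \<Rightarrow> 'w \<Rightarrow> bool" where
  "bruhat_le W S = (bruhat_step W S)\<^sup>*\<^sup>*"

definition bruhat_less :: "('w, 'm) monoid_scheme \<Rightarrow> 'w set \<Rightarrow> 'w \<Rightarrow> 'w \<Rightarrow> bool" where
  "bruhat_less W S x y \<longleftrightarrow> bruhat_le W S x y \<and> x \<noteq> y"


text \<open>
  The Hecke algebra of \<open>(W, S)\<close>: an associative unital ring (the type \<open>'h\<close>) that is an algebra
  over the Laurent polynomials through \<open>scale\<close> and is free as a module with basis \<open>(t y)\<close>
  indexed by the elements \<open>y\<close> of \<open>W\<close>.
\<close>

locale hecke_algebra = module scale
  for scale :: "laurent \<Rightarrow> 'h::ring_1 \<Rightarrow> 'h" (infixr \<open>*s\<close> 75) +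
  fixes W :: "('w, 'm) monoid_scheme" (structure)
    and S :: "'w set"
    and t :: "'w \<Rightarrow> 'h"
  assumes scale_mult_left: "(a *s g) * h = a *s (g * h)"
    and scale_mult_right: "g * (a *s h) = a *s (g * h)"
    and basis_inj: "inj_on t (carrier W)"
    and basis_independent: "independent (t ` carrier W)"
    and basis_span: "span (t ` carrier W) = UNIV"
    and mult_up: "\<lbrakk>s \<in> S; y \<in> carrier W; bruhat_less W S y (s \<otimes> y)\<rbrakk> \<Longrightarrow> t s * t y = t (s \<otimes> y)"
    and mult_down: "\<lbrakk>s \<in> S; y \<in> carrier W; bruhat_less W S (s \<otimes> y) y\<rbrakk> \<Longrightarrow>
      t s * t y = (v - v_inv) *s t y + t (s \<otimes> y)"

text \<open>
  The ring involution is called \<open>\<iota>\<close>; the value \<open>\<iota> (t y)\<close> is characterised as the two-sided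
  inverse of \<open>t (inv y)\<close>.
\<close>

locale hecke_involution = hecke_algebra scale W S t
  for scale :: "laurent \<Rightarrow> 'h::ring_1 \<Rightarrow> 'h" (infixr \<open>*s\<close> 75)
    and W :: "('w, 'm) monoid_scheme" (structure)
    and S :: "'w set"
    and t :: "'w \<Rightarrow> 'h" +
  fixes \<iota> :: "'h \<Rightarrow> 'h"
  assumes \<iota>_add: "\<iota> (g + h) = \<iota> g + \<iota> h"
    and \<iota>_mult: "\<iota> (g * h) = \<iota> g * \<iota> h"
    and \<iota>_one: "\<iota> 1 = 1"
    and \<iota>_invol: "\<iota> (\<iota> h) = h"
    and \<iota>_v: "\<iota> (v *s 1) = v_inv *s 1"
    and \<iota>_basis: "y \<in> carrier W \<Longrightarrow> \<iota> (t y) * t (inv y) = 1 \<and> t (inv y) * \<iota> (t y) = 1"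

locale kazhdan_lusztig_basis = hecke_involution scale W S t \<iota>
  for scale :: "laurent \<Rightarrow> 'h::ring_1 \<Rightarrow> 'h" (infixr \<open>*s\<close> 75)
    and W :: "('w, 'm) monoid_scheme" (structure)
    and S :: "'w set"
    and t :: "'w \<Rightarrow> 'h"
    and \<iota> :: "'h \<Rightarrow> 'h" +
  fixes c :: "'w \<Rightarrow> 'h"
  assumes c_invariant: "y \<in> carrier W \<Longrightarrow> \<iota> (c y) = c y"
    and c_unitriangular: "y \<in> carrier W \<Longrightarrow>
      \<exists>p. (\<forall>x. p x \<in> negative_laurent) \<and>
          c y = t y + (\<Sum>x\<in>{x \<in> carrier W. bruhat_less W S x y}. p x *s t x)"


locale infinite_dihedral = group W
  for W :: "('w, 'm) monoid_scheme" (structure) +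
  fixes s1 s2 :: 'w
  assumes s1_closed: "s1 \<in> carrier W" and s2_closed: "s2 \<in> carrier W"
    and s1_order: "s1 \<noteq> \<one>" "s1 \<otimes> s1 = \<one>"
    and s2_order: "s2 \<noteq> \<one>" "s2 \<otimes> s2 = \<one>"
    and generated: "generate W {s1, s2} = carrier W"
    and infinite_order: "n > 0 \<Longrightarrow> (s1 \<otimes> s2) [^] (n::nat) \<noteq> \<one>"

text \<open>The product $\langle j, a, b] = \ldots a b$ of \<open>j\<close> alternating factors ending in \<open>b\<close>.\<close>

primrec alt :: "('w, 'm) monoid_scheme \<Rightarrow> nat \<Rightarrow> 'w \<Rightarrow> 'w \<Rightarrow> 'w" where
  "alt W 0 a b = \<one>\<^bsub>W\<^esub>"
| "alt W (Suc j) a b = alt W j b a \<otimes>\<^bsub>W\<^esub> b"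

end

theory Submission
  imports Defs
begin

text \<open>
  In the infinite dihedral group every element shorter than \<open>w\<close> lies below \<open>w\<close>, and
  $c_w = \sum_{x \le w} v^{l(x) - l(w)} t_x$: the right-hand sides satisfy
  $c_s c_w = c_{sw} + c_{w'}$ for $sw > w$, where \<open>w'\<close> is \<open>w\<close> without its first factor
  (the last term is absent for $l(w) = 1$), hence are fixed by the involution, and an
  invariant combination of the $t_x$ with coefficients in $v^{-1} {\bf Z}[v^{-1}]$ vanishes.
  Extending $C_j$ to an odd function of $j \in {\bf Z}$, this rule together with
  $c_s C_j = (v + v^{-1}) C_j$ for \<open>s\<close> the first factor is a Chebyshev recurrence for
  $c_{\langle i, s, t]} C_k$ in \<open>i\<close>. Its solution is a sum over an interval of indices, and
  the cases \<open>i > k\<close> come from the cancellation of opposite indices.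
\<close>

section \<open>Reduced words in the infinite dihedral group\<close>

text \<open>\<open>alt\<close> grows at its last letter, this word at its first: the Hecke relations
  describe only left multiplication by a generator.\<close>

primrec lalt :: "('w, 'm) monoid_scheme \<Rightarrow> nat \<Rightarrow> 'w \<Rightarrow> 'w \<Rightarrow> 'w" where
  "lalt W 0 x y = \<one>\<^bsub>W\<^esub>"
| "lalt W (Suc j) x y = x \<otimes>\<^bsub>W\<^esub> lalt W j y x"

lemma bruhat_less_imp_word_length_less:
  assumes "bruhat_less W S x y"
  shows "word_length W S x < word_length W S y"
proof -
  have "(bruhat_step W S)\<^sup>*\<^sup>* x y \<Longrightarrow> x = y \<or> word_length W S x < word_length W S y"
    by (induction rule: rtranclp_induct) (auto simp: bruhat_step_def)
  then show ?thesis
    using assms by (auto simp: bruhat_less_def bruhat_le_def)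
qed

context infinite_dihedral
begin

text \<open>The ordered pair stays variable in inductions because stripping the first letter of an
  alternating word exchanges the two generators.\<close>

abbreviation gen_pair :: "'w \<Rightarrow> 'w \<Rightarrow> bool" where
  "gen_pair x y \<equiv> (x, y) \<in> {(s1, s2), (s2, s1)}"

lemma gen_pair_swap: "gen_pair x y \<Longrightarrow> gen_pair y x"
  by auto

lemma gen_pair_closed: "gen_pair x y \<Longrightarrow> x \<in> carrier W \<and> y \<in> carrier W"
  using s1_closed s2_closed by auto

lemma gen_pair_square: "gen_pair x y \<Longrightarrow> x \<otimes> x = \<one>"
  using s1_order s2_order by auto

lemma gen_pair_inv: "gen_pair x y \<Longrightarrow> inv x = x"
  using gen_pair_square[of x y] gen_pair_closed[of x y] by (intro inv_equality) auto

lemma gen_pair_cancel: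
  "gen_pair x y \<Longrightarrow> w \<in> carrier W \<Longrightarrow> x \<otimes> (x \<otimes> w) = w"
  using gen_pair_square[of x y] gen_pair_closed[of x y] by (simp flip: m_assoc)

lemma lalt_closed: "gen_pair x y \<Longrightarrow> lalt W j x y \<in> carrier W"
  using s1_closed s2_closed by (induction j arbitrary: x y) auto

lemma lalt_double:
  assumes "gen_pair x y"
  shows "lalt W (2 * m) x y = (x \<otimes> y) [^] m"
proof (induction m)
  case 0
  then show ?case by simp
next
  case (Suc m)
  have "(x \<otimes> y) [^] Suc m = (x \<otimes> y) \<otimes> (x \<otimes> y) [^] m"
    using gen_pair_closed[OF assms] by (intro nat_pow_Suc2) simp
  then show ?case
    using Suc gen_pair_closed[OF assms] by (simp add: m_assoc del: nat_pow_Suc)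
qed

lemma gen_pair_pow_neq_one:
  assumes "gen_pair x y" "n > 0"
  shows "(x \<otimes> y) [^] (n::nat) \<noteq> \<one>"
proof -
  have "s2 \<otimes> s1 = inv (s1 \<otimes> s2)"
    using s1_closed s2_closed gen_pair_inv[of s1 s2] gen_pair_inv[of s2 s1]
    by (simp add: inv_mult_group)
  then have "(s2 \<otimes> s1) [^] n = inv ((s1 \<otimes> s2) [^] n)"
    using s1_closed s2_closed by (simp add: nat_pow_inv)
  then have "(s2 \<otimes> s1) [^] n \<noteq> \<one>"
    using infinite_order[OF assms(2)] s1_closed s2_closed by (simp add: inv_eq_1_iff)
  then show ?thesis
    using assms infinite_order by auto
qed

text \<open>An even word is a power of a product of the two generators, which has infinite order. An
  odd word equal to one would make such a power equal to the involution \<open>x\<close>, so its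
  square would be one; this leaves a single letter, which differs from one.\<close>

lemma lalt_neq_one:
  assumes "gen_pair x y" "j > 0"
  shows "lalt W j x y \<noteq> \<one>"
proof (cases "even j")
  case True
  then show ?thesis
    using assms lalt_double gen_pair_pow_neq_one by (metis dvdE nat_0_less_mult_iff)
next
  case False
  then obtain m where j: "j = Suc (2 * m)"
    by (elim oddE) simp
  note cl = gen_pair_closed[OF assms(1)] and sw = gen_pair_swap[OF assms(1)]
  show ?thesis
  proof
    assume "lalt W j x y = \<one>"
    then have "x \<otimes> (y \<otimes> x) [^] m = \<one>"
      using lalt_double[OF sw] j by simp
    then have *: "(y \<otimes> x) [^] m = x"
      using gen_pair_cancel[OF assms(1), of "(y \<otimes> x) [^] m"] cl by simp
    then have "(y \<otimes> x) [^] (m + m) = \<one>"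
      using cl gen_pair_square[OF assms(1)] by (simp flip: nat_pow_mult)
    then have "m = 0"
      using gen_pair_pow_neq_one[OF sw, of "m + m"] by auto
    with * show False
      using assms(1) s1_order s2_order by auto
  qed
qed

text \<open>Moving the first letter across the equation shortens the left word and lengthens the
  right one, until a nonempty alternating word would have to equal one.\<close>

lemma lalt_eq_swap_imp_zero:
  "gen_pair x y \<Longrightarrow> lalt W i x y = lalt W j y x \<Longrightarrow> i = 0 \<and> j = 0"
proof (induction i arbitrary: j x y)
  case 0
  then show ?case
    using lalt_neq_one[of y x j] gen_pair_swap[of x y] by force
next
  case (Suc i)
  note sw = gen_pair_swap[OF Suc.prems(1)]
  have "lalt W i y x = x \<otimes> (x \<otimes> lalt W i y x)"
    using gen_pair_cancel[OF Suc.prems(1)] lalt_closed[OF sw] by simp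
  then have "lalt W i y x = lalt W (Suc j) x y"
    using Suc.prems(2) by simp
  then show ?case
    using Suc.IH[OF sw] by blast
qed

lemma lalt_inj: "gen_pair x y \<Longrightarrow> lalt W i x y = lalt W j x y \<Longrightarrow> i = j"
proof (induction i arbitrary: j x y)
  case 0
  then show ?case
    using lalt_neq_one[of x y j] by force
next
  case (Suc i)
  note sw = gen_pair_swap[OF Suc.prems(1)]
  show ?case
  proof (cases j)
    case 0
    then show ?thesis
      using lalt_neq_one[OF Suc.prems(1), of "Suc i"] Suc.prems(2) by simp
  next
    case (Suc j')
    then have "lalt W i y x = lalt W j' y x"
      using Suc.prems lalt_closed[OF sw] gen_pair_closed[OF Suc.prems(1)] by simp
    then show ?thesis
      using Suc.IH[OF sw] Suc by simp
  qed
qed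

lemma lalt_eq_imp_length_eq:
  "gen_pair x y \<Longrightarrow> gen_pair x' y' \<Longrightarrow> lalt W i x y = lalt W j x' y' \<Longrightarrow> i = j"
  using lalt_inj[of x y i j] lalt_eq_swap_imp_zero[of x y i j] by auto

section \<open>Normal forms and word length\<close>

lemma gen_mult_lalt:
  assumes "s \<in> {s1, s2}" "gen_pair x y"
  shows "\<exists>j' x' y'. j' \<le> Suc j \<and> gen_pair x' y' \<and> s \<otimes> lalt W j x y = lalt W j' x' y'"
proof (cases "s = x \<and> j > 0")
  case True
  then obtain i where i: "j = Suc i"
    using gr0_conv_Suc by blast
  have "s \<otimes> lalt W j x y = lalt W i y x"
    using True i gen_pair_cancel[OF assms(2)] lalt_closed[OF gen_pair_swap[OF assms(2)]] by simp
  then show ?thesis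
    using i gen_pair_swap[OF assms(2)] by (intro exI[of _ i] exI[of _ y] exI[of _ x]) simp
next
  case False
  show ?thesis
  proof (cases "j = 0")
    case True
    \<comment> \<open>The empty word is the same for both pairs, so the pair is chosen afresh to
      start with \<open>s\<close>.\<close>
    then show ?thesis
      using assms by (intro exI[of _ 1] exI[of _ s] exI[of _ "if s = s1 then s2 else s1"]) auto
  next
    case j: False
    then have "s = y"
      using False assms by auto
    then show ?thesis
      using gen_pair_swap[OF assms(2)]
      by (intro exI[of _ "Suc j"] exI[of _ y] exI[of _ x]) simp
  qed
qed

lemma word_eq_lalt:
  "set ws \<subseteq> {s1, s2} \<Longrightarrow>
    \<exists>j x y. j \<le> length ws \<and> gen_pair x y \<and> foldr (\<otimes>) ws \<one> = lalt W j x y"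
proof (induction ws)
  case Nil
  then show ?case
    by (intro exI[of _ 0] exI[of _ s1] exI[of _ s2]) simp
next
  case (Cons s ws)
  then obtain j x y where j: "j \<le> length ws" "gen_pair x y" "foldr (\<otimes>) ws \<one> = lalt W j x y"
    by auto
  have "s \<in> {s1, s2}"
    using Cons.prems by simp
  from gen_mult_lalt[OF this j(2), of j] j show ?case
    by (metis Suc_le_mono foldr_Cons comp_apply le_trans length_Cons)
qed

lemma lalt_eq_word:
  "gen_pair x y \<Longrightarrow>
    \<exists>ws. set ws \<subseteq> {s1, s2} \<and> length ws = j \<and> foldr (\<otimes>) ws \<one> = lalt W j x y"
proof (induction j arbitrary: x y)
  case 0
  then show ?case by simp
next
  case (Suc j)
  from Suc.IH[OF gen_pair_swap[OF Suc.prems]] obtain ws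
    where "set ws \<subseteq> {s1, s2}" "length ws = j" "foldr (\<otimes>) ws \<one> = lalt W j y x"
    by blast
  then show ?case
    using Suc.prems by (intro exI[of _ "x # ws"]) auto
qed

text \<open>Cancellation turns any word into an alternating one that is no longer, and the length of
  an alternating word is determined by the element it represents.\<close>

lemma word_length_lalt:
  assumes "gen_pair x y"
  shows "word_length W {s1, s2} (lalt W j x y) = j"
  unfolding word_length_def
proof (rule Least_equality)
  show "\<exists>ws. set ws \<subseteq> {s1, s2} \<and> length ws = j \<and> foldr (\<otimes>) ws \<one> = lalt W j x y"
    using lalt_eq_word[OF assms] .
next
  fix n
  assume "\<exists>ws. set ws \<subseteq> {s1, s2} \<and> length ws = n \<and> foldr (\<otimes>) ws \<one> = lalt W j x y"
  then obtain ws where ws: "set ws \<subseteq> {s1, s2}" "length ws = n" "foldr (\<otimes>) ws \<one> = lalt W j x y"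
    by blast
  from word_eq_lalt[OF ws(1)] obtain i x' y'
    where i: "i \<le> n" "gen_pair x' y'" "foldr (\<otimes>) ws \<one> = lalt W i x' y'"
    using ws(2) by auto
  then show "j \<le> n"
    using lalt_eq_imp_length_eq[OF assms i(2)] ws(3) by auto
qed

lemma carrier_eq_lalt:
  assumes "w \<in> carrier W"
  shows "\<exists>j x y. gen_pair x y \<and> w = lalt W j x y"
proof -
  define H where "H = {lalt W j x y | j x y. gen_pair x y}"
  have H: "z \<in> carrier W" if "z \<in> H" for z
    using that lalt_closed unfolding H_def by blast
  have gen: "s \<otimes> z \<in> H" if "s \<in> {s1, s2}" "z \<in> H" for s z
    using that gen_mult_lalt unfolding H_def by blast
  have "w \<in> generate W {s1, s2}"
    using assms generated by simp
  \<comment> \<open>Quantifying over all of \<open>H\<close> makes the case \<open>eng\<close> a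
    composition of two maps from \<open>H\<close> to itself. Applying the result to the unit, which
    lies in \<open>H\<close>, gives the claim.\<close>
  then have "\<forall>z\<in>H. w \<otimes> z \<in> H"
  proof (induction rule: generate.induct)
    case one
    then show ?case using H by simp
  next
    case (incl h)
    then show ?case using gen by blast
  next
    case (inv h)
    then have "inv h = h"
      using gen_pair_inv[of s1 s2] gen_pair_inv[of s2 s1] by auto
    then show ?case using gen inv by auto
  next
    case (eng h1 h2)
    then have "h1 \<in> carrier W" "h2 \<in> carrier W"
      using generated by auto
    then show ?case using eng H by (simp add: m_assoc)
  qed
  moreover have "\<one> \<in> H"
    unfolding H_def by (intro CollectI exI[of _ 0] exI[of _ s1] exI[of _ s2]) simp
  ultimately have "w \<in> H"
    using assms by force
  then show ?thesis
    unfolding H_def by blast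
qed

section \<open>Bruhat order and passage between the two kinds of words\<close>

lemma bruhat_less_lalt_Suc:
  assumes "gen_pair x y"
  shows "bruhat_less W {s1, s2} (lalt W j y x) (lalt W (Suc j) x y)"
proof -
  let ?w = "lalt W j y x"
  note sw = gen_pair_swap[OF assms]
  have w: "?w \<in> carrier W"
    by (rule lalt_closed[OF sw])
  have x: "x \<in> carrier W" "x \<in> {s1, s2}"
    using gen_pair_closed[OF assms] assms by auto
  \<comment> \<open>Bruhat steps multiply on the right, so left multiplication by \<open>x\<close>
    is rewritten as right multiplication by a conjugate of \<open>x\<close>, which is a
    reflection.\<close>
  have "lalt W (Suc j) x y = ?w \<otimes> (inv ?w \<otimes> x \<otimes> inv (inv ?w))"
    using w x by (simp flip: m_assoc)
  moreover have "inv ?w \<otimes> x \<otimes> inv (inv ?w) \<in> reflections W {s1, s2}"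
    unfolding reflections_def using w x(2) inv_closed by blast
  moreover have "word_length W {s1, s2} ?w < word_length W {s1, s2} (lalt W (Suc j) x y)"
    by (simp only: word_length_lalt[OF assms] word_length_lalt[OF sw] lessI)
  ultimately have "bruhat_step W {s1, s2} ?w (lalt W (Suc j) x y)"
    unfolding bruhat_step_def using w by blast
  moreover from this have "?w \<noteq> lalt W (Suc j) x y"
    by (auto simp: bruhat_step_def)
  ultimately show ?thesis
    by (auto simp: bruhat_less_def bruhat_le_def)
qed

lemma lalt_Suc_right:
  "gen_pair x y \<Longrightarrow> lalt W (Suc j) x y = lalt W j x y \<otimes> (if even j then x else y)"
proof (induction j arbitrary: x y)
  case 0
  then show ?case
    using gen_pair_closed[of x y] by simp
next
  case (Suc j)
  note sw = gen_pair_swap[OF Suc.prems]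
  show ?case
    using Suc.IH[OF sw] gen_pair_closed[OF Suc.prems] lalt_closed[OF sw, of j]
    by (simp add: m_assoc)
qed

lemma alt_eq_lalt:
  "gen_pair x y \<Longrightarrow> alt W j x y = (if even j then lalt W j x y else lalt W j y x)"
proof (induction j arbitrary: x y)
  case 0
  then show ?case by simp
next
  case (Suc j)
  note sw = gen_pair_swap[OF Suc.prems]
  show ?case
    using Suc.IH[OF sw] lalt_Suc_right[OF sw, of j] lalt_Suc_right[OF Suc.prems, of j]
    by (simp del: lalt.simps(2))
qed

end
section \<open>Laurent polynomials\<close>

text \<open>The ring involution of the Laurent polynomials that exchanges \<open>v\<close> and
  \<open>v_inv\<close>.\<close>

definition bar :: "laurent \<Rightarrow> laurent" where
  "bar = Poly_Mapping.map_key uminus"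

lemma lookup_bar: "Poly_Mapping.lookup (bar p) n = Poly_Mapping.lookup p (- n)"
  unfolding bar_def by (simp add: Poly_Mapping.map_key.rep_eq)

lemma bar_diff: "bar (p - q) = bar p - bar q"
  by (rule poly_mapping_eqI) (simp add: lookup_bar lookup_minus)

lemma bar_add: "bar (p + q) = bar p + bar q"
  by (rule poly_mapping_eqI) (simp add: lookup_bar lookup_add)

lemma bar_zero: "bar 0 = 0"
  by (rule poly_mapping_eqI) (simp add: lookup_bar)

lemma bar_single: "bar (Poly_Mapping.single n a) = Poly_Mapping.single (- n) a"
  by (rule poly_mapping_eqI) (auto simp: lookup_bar lookup_single when_def)

lemma bar_v_inv: "bar v_inv = v"
  by (simp add: v_inv_def v_def bar_single)

lemma v_mult_v_inv: "v * v_inv = 1" "v_inv * v = 1"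
  by (simp_all add: v_def v_inv_def mult_single)

lemma negative_laurent_iff:
  "p \<in> negative_laurent \<longleftrightarrow> (\<forall>n\<ge>0. Poly_Mapping.lookup p n = 0)"
proof -
  have "p \<in> negative_laurent \<longleftrightarrow> (\<forall>n. Poly_Mapping.lookup p n \<noteq> 0 \<longrightarrow> n < 0)"
    unfolding negative_laurent_def subset_iff mem_Collect_eq in_keys_iff lessThan_iff ..
  then show ?thesis
    by (meson linorder_not_le)
qed

lemma negative_laurent_zero: "0 \<in> negative_laurent"
  by (simp add: negative_laurent_iff)

lemma negative_laurent_add:
  "p \<in> negative_laurent \<Longrightarrow> q \<in> negative_laurent \<Longrightarrow> p + q \<in> negative_laurent"
  by (simp add: negative_laurent_iff lookup_add)

lemma negative_laurent_diff:
  "p \<in> negative_laurent \<Longrightarrow> q \<in> negative_laurent \<Longrightarrow> p - q \<in> negative_laurent"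
  by (simp add: negative_laurent_iff lookup_minus)

lemma negative_laurent_v_inv: "v_inv \<in> negative_laurent"
  by (simp add: negative_laurent_iff v_inv_def lookup_single when_def)

lemma negative_laurent_mult:
  assumes "p \<in> negative_laurent" "q \<in> negative_laurent"
  shows "p * q \<in> negative_laurent"
  unfolding negative_laurent_def
proof (intro CollectI subsetI)
  fix n
  assume "n \<in> Poly_Mapping.keys (p * q)"
  then obtain a b where "n = a + b" "a \<in> Poly_Mapping.keys p" "b \<in> Poly_Mapping.keys q"
    using keys_mult[of p q] by blast
  moreover from this have "a < 0" "b < 0"
    using assms unfolding negative_laurent_def by blast+
  ultimately show "n \<in> {..<0}"
    by simp
qed

text \<open>Invariance makes the coefficients symmetric in the exponent, so those at negative
  exponents equal those at positive ones, which vanish.\<close>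

lemma negative_laurent_bar_fixed_imp_zero:
  assumes "p \<in> negative_laurent" "bar p = p"
  shows "p = 0"
proof (rule poly_mapping_eqI)
  fix n
  show "Poly_Mapping.lookup p n = Poly_Mapping.lookup 0 n"
  proof (cases "n \<ge> 0")
    case True
    then show ?thesis using assms(1) by (simp add: negative_laurent_iff)
  next
    case False
    then have "Poly_Mapping.lookup p (- n) = 0"
      using assms(1) by (simp add: negative_laurent_iff)
    then show ?thesis using lookup_bar[of p n] assms(2) by simp
  qed
qed

section \<open>Coefficients and semilinearity\<close>

context hecke_algebra
begin

definition coef :: "'w \<Rightarrow> 'h \<Rightarrow> laurent" where
  "coef w h = representation (t ` carrier W) h (t w)"

lemma coef_add: "coef w (g + h) = coef w g + coef w h"
  unfolding coef_def by (simp add: representation_add basis_independent basis_span)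

lemma coef_diff: "coef w (g - h) = coef w g - coef w h"
  unfolding coef_def by (simp add: representation_diff basis_independent basis_span)

lemma coef_zero: "coef w 0 = 0"
  unfolding coef_def by (simp add: representation_zero)

lemma coef_scale: "coef w (a *s h) = a * coef w h"
  unfolding coef_def by (simp add: representation_scale basis_independent basis_span)

lemma coef_basis:
  assumes "u \<in> carrier W" "w \<in> carrier W"
  shows "coef w (t u) = (if u = w then 1 else 0)"
  using assms inj_onD[OF basis_inj, of w u] unfolding coef_def
  by (auto simp: representation_basis[OF basis_independent])

text \<open>This is the lattice of error terms that a Kazhdan-Lusztig basis element may have beyond
  its leading term.\<close>

definition negative_span :: "'h set" where
  "negative_span = {h. \<forall>w\<in>carrier W. coef w h \<in> negative_laurent}"

lemma negative_span_zero: "0 \<in> negative_span"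
  by (simp add: negative_span_def coef_zero negative_laurent_zero)

lemma negative_span_add:
  "g \<in> negative_span \<Longrightarrow> h \<in> negative_span \<Longrightarrow> g + h \<in> negative_span"
  by (simp add: negative_span_def coef_add negative_laurent_add)

lemma negative_span_diff:
  "g \<in> negative_span \<Longrightarrow> h \<in> negative_span \<Longrightarrow> g - h \<in> negative_span"
  by (simp add: negative_span_def coef_diff negative_laurent_diff)

lemma negative_span_scale:
  "a \<in> negative_laurent \<Longrightarrow> h \<in> negative_span \<Longrightarrow> a *s h \<in> negative_span"
  by (simp add: negative_span_def coef_scale negative_laurent_mult)

lemma negative_span_basis:
  "a \<in> negative_laurent \<Longrightarrow> w \<in> carrier W \<Longrightarrow> a *s t w \<in> negative_span"
  by (auto simp: negative_span_def coef_scale coef_basis negative_laurent_zero)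

lemma negative_span_sum:
  "(\<And>x. x \<in> A \<Longrightarrow> f x \<in> negative_span) \<Longrightarrow> sum f A \<in> negative_span"
  by (induction A rule: infinite_finite_induct)
     (auto simp: negative_span_zero negative_span_add)

text \<open>With the strict inequality layer 0 is trivial, and the layer numbered by the length of
  \<open>w\<close> consists of the combinations of strictly shorter elements.\<close>

definition filtration :: "nat \<Rightarrow> 'h set" where
  "filtration n = span (t ` {w \<in> carrier W. word_length W S w < n})"

lemma filtration_zero: "filtration 0 = {0}"
  by (simp add: filtration_def)

lemma filtration_mono: "m \<le> n \<Longrightarrow> filtration m \<subseteq> filtration n"
  unfolding filtration_def by (intro span_mono) auto

lemma filtration_basis:
  "w \<in> carrier W \<Longrightarrow> word_length W S w < n \<Longrightarrow> t w \<in> filtration n"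
  unfolding filtration_def by (intro span_base) auto

lemmas filtration_add =
  span_add[of _ "t ` {w \<in> carrier W. word_length W S w < n}" for n, folded filtration_def]
lemmas filtration_diff =
  span_diff[of _ "t ` {w \<in> carrier W. word_length W S w < n}" for n, folded filtration_def]
lemmas filtration_scale =
  span_scale[of _ "t ` {w \<in> carrier W. word_length W S w < n}" for n, folded filtration_def]
lemmas filtration_sum =
  span_sum[of _ _ "t ` {w \<in> carrier W. word_length W S w < n}" for n, folded filtration_def]

lemma filtration_induct [consumes 1, case_names zero step]:
  assumes "h \<in> filtration n" "P 0"
    and "\<And>a w g. w \<in> carrier W \<Longrightarrow> word_length W S w < n \<Longrightarrow> P g \<Longrightarrow> P (a *s t w + g)"
  shows "P h"
  using assms(1) unfolding filtration_def
  by (rule span_induct_alt) (use assms(2,3) in auto)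

lemma coef_filtration:
  assumes "h \<in> filtration n" "w \<in> carrier W" "n \<le> word_length W S w"
  shows "coef w h = 0"
  using assms(1)
  by (induction rule: filtration_induct)
     (use assms(2,3) in \<open>auto simp: coef_zero coef_add coef_scale coef_basis\<close>)

lemma filtrationI:
  assumes "\<And>w. w \<in> carrier W \<Longrightarrow> n \<le> word_length W S w \<Longrightarrow> coef w h = 0"
  shows "h \<in> filtration n"
proof -
  let ?R = "representation (t ` carrier W) h"
  have "b \<in> filtration n" if b: "?R b \<noteq> 0" for b
  proof -
    obtain w where "w \<in> carrier W" "b = t w"
      using representation_ne_zero[OF b] by blast
    then show ?thesis
      using b assms[of w] filtration_basis unfolding coef_def by fastforce
  qed
  then have "(\<Sum>b | ?R b \<noteq> 0. ?R b *s b) \<in> filtration n"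
    by (auto intro!: filtration_sum filtration_scale)
  then show ?thesis
    using sum_nonzero_representation_eq[of "t ` carrier W" h] basis_independent basis_span by simp
qed

end

section \<open>Semilinearity of the involution\<close>

context hecke_involution
begin

lemma \<iota>_zero: "\<iota> 0 = 0"
  using \<iota>_add[of 0 0] by simp

lemma \<iota>_diff: "\<iota> (g - h) = \<iota> g - \<iota> h"
  using \<iota>_add[of "g - h" h] by (simp add: algebra_simps)

text \<open>On scalars the axioms prescribe the involution only at \<open>v\<close>.
  Multiplicativity extends this to all powers of \<open>v\<close>, additivity to all Laurent
  polynomials, and the identity \<open>a *s h = (a *s 1) * h\<close> to the whole module.\<close>

lemma \<iota>_scale: "\<iota> (a *s h) = bar a *s \<iota> h"
proof -
  have mult1: "(a *s 1) * (b *s 1) = (a * b) *s 1" for a b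
    by (simp add: scale_mult_left)
  have v_inv: "\<iota> (v_inv *s 1) = v *s 1"
    using \<iota>_invol[of "v *s 1"] \<iota>_v by simp
  have pos: "\<iota> (Poly_Mapping.single (int n) 1 *s 1) = Poly_Mapping.single (- int n) 1 *s 1" for n
  proof (induction n)
    case 0
    then show ?case by (simp add: \<iota>_one)
  next
    case (Suc n)
    have "Poly_Mapping.single (int (Suc n)) 1 = v * Poly_Mapping.single (int n) (1::int)"
      and "Poly_Mapping.single (- int (Suc n)) 1 = v_inv * Poly_Mapping.single (- int n) (1::int)"
      by (simp_all add: v_def v_inv_def mult_single)
    then show ?case
      using Suc by (simp only: flip: mult1) (simp only: \<iota>_mult \<iota>_v)
  qed
  have neg: "\<iota> (Poly_Mapping.single (- int n) 1 *s 1) = Poly_Mapping.single (int n) 1 *s 1" for n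
    using \<iota>_invol[of "Poly_Mapping.single (int n) 1 *s 1"] pos by simp
  \<comment> \<open>Additively the Laurent polynomials are the free abelian group on the exponents,
    so induction over monomials and differences suffices.\<close>
  have "Poly_Mapping.keys a \<subseteq> UNIV"
    by simp
  then have one: "\<iota> (a *s 1) = bar a *s 1"
  proof (induction a rule: frag_induction)
    case zero
    then show ?case by (simp add: bar_zero \<iota>_zero)
  next
    case (one n)
    then show ?case
      using pos neg by (cases n rule: int_cases2) (simp_all add: bar_single)
  next
    case (diff a b)
    then show ?case
      by (simp add: bar_diff scale_left_diff_distrib \<iota>_diff)
  qed
  have "\<iota> (a *s h) = \<iota> ((a *s 1) * h)"
    by (simp add: scale_mult_left)
  also have "\<dots> = (bar a *s 1) * \<iota> h"
    by (simp only: \<iota>_mult one)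
  also have "\<dots> = bar a *s \<iota> h"
    by (simp add: scale_mult_left)
  finally show ?thesis .
qed

end

section \<open>The Kazhdan-Lusztig basis of the infinite dihedral group\<close>

locale dihedral_hecke =
  infinite_dihedral W s1 s2 + kazhdan_lusztig_basis scale W "{s1, s2}" t \<iota> c
  for scale :: "laurent \<Rightarrow> 'h::ring_1 \<Rightarrow> 'h" (infixr \<open>*s\<close> 75)
    and W :: "('w, 'm) monoid_scheme" (structure)
    and s1 s2 :: 'w
    and t :: "'w \<Rightarrow> 'h"
    and \<iota> :: "'h \<Rightarrow> 'h"
    and c :: "'w \<Rightarrow> 'h"
begin

text \<open>The relation for \<open>s1\<close> and the unit gives
  \<open>t s1 * t \<one> = t s1\<close>, and \<open>t s1\<close> is invertible by the axiom on the
  involution, since \<open>s1\<close> is its own inverse.\<close>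

lemma t_one: "t \<one> = 1"
proof -
  have "bruhat_less W {s1, s2} \<one> (s1 \<otimes> \<one>)"
    using bruhat_less_lalt_Suc[of s1 s2 0] by simp
  then have "t s1 * t \<one> = t s1"
    using mult_up[of s1 \<one>] s1_closed by simp
  then have "\<iota> (t s1) * t (inv s1) * t \<one> = \<iota> (t s1) * t (inv s1)"
    using gen_pair_inv[of s1 s2] by (simp add: mult.assoc)
  then show ?thesis
    using \<iota>_basis[OF s1_closed] by simp
qed

section \<open>Left multiplication by a generator\<close>

lemma t_mult_up:
  assumes "gen_pair x y"
  shows "t x * t (lalt W j y x) = t (lalt W (Suc j) x y)"
  using mult_up[of x "lalt W j y x"] bruhat_less_lalt_Suc[OF assms, of j]
    lalt_closed[OF gen_pair_swap[OF assms]] assms by auto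

lemma t_mult_down:
  assumes "gen_pair x y"
  shows "t x * t (lalt W (Suc j) x y) = (v - v_inv) *s t (lalt W (Suc j) x y) + t (lalt W j y x)"
proof -
  have "x \<otimes> lalt W (Suc j) x y = lalt W j y x"
    using gen_pair_cancel[OF assms] lalt_closed[OF gen_pair_swap[OF assms]] by simp
  then show ?thesis
    using mult_down[of x "lalt W (Suc j) x y"] bruhat_less_lalt_Suc[OF assms, of j]
      lalt_closed[OF assms] assms by (auto simp del: lalt.simps)
qed

text \<open>\<open>ball j\<close> is the sum of $v^{l(w) - j} t_w$ over all $w$ of length at most $j$.\<close>

primrec ball :: "nat \<Rightarrow> 'h" where
  "ball 0 = 1"
| "ball (Suc j) = t (lalt W (Suc j) s1 s2) + t (lalt W (Suc j) s2 s1) + v_inv *s ball j"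

text \<open>\<open>kl j\<close> belongs to an element of length \<open>j + 1\<close>.\<close>

definition kl :: "nat \<Rightarrow> 'w \<Rightarrow> 'w \<Rightarrow> 'h" where
  "kl j x y = t (lalt W (Suc j) x y) + v_inv *s ball j"

text \<open>Indexed by the length of the word itself, in contrast to \<open>kl\<close>. The value at
  length 0 is zero and not 1, so that the rules for multiplication by a generator need no exception
  for short words.\<close>

definition kl_below :: "nat \<Rightarrow> 'w \<Rightarrow> 'w \<Rightarrow> 'h" where
  "kl_below j x y = (case j of 0 \<Rightarrow> 0 | Suc i \<Rightarrow> kl i x y)"

text \<open>One of the two words of length \<open>j\<close> is isolated; the other one together with
  all shorter elements makes up a single basis element.\<close>

lemma ball_split:
  assumes "gen_pair x y"
  shows "ball j = t (lalt W j y x) + kl_below j x y"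
  using assms by (cases j) (auto simp: kl_below_def kl_def t_one add_ac simp del: lalt.simps(2))

lemma v_scale_v_inv: "v *s (v_inv *s h) = h" "v_inv *s (v *s h) = h"
  by (simp_all add: v_mult_v_inv)

text \<open>The elements below a word starting with \<open>x\<close> pair up under left
  multiplication by \<open>x\<close>, and each combination
  \<open>t (x \<otimes> u) + v_inv *s t u\<close> with \<open>u\<close> the shorter partner is an
  eigenvector of \<open>t x\<close> with eigenvalue \<open>v\<close>. The induction splits off the
  longest such pair.\<close>

lemma t_mult_kl_below:
  assumes "gen_pair x y"
  shows "t x * kl_below j x y = v *s kl_below j x y"
proof (induction j)
  case 0
  then show ?case by (simp add: kl_below_def)
next
  case (Suc j)
  let ?z = "t (lalt W (Suc j) x y)" and ?y = "t (lalt W j y x)" and ?r = "kl_below j x y"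
  have kl: "kl_below (Suc j) x y = ?z + v_inv *s ?y + v_inv *s ?r"
    using ball_split[OF assms, of j]
    by (simp add: kl_below_def kl_def scale_right_distrib add.assoc del: lalt.simps)
  have "t x * kl_below (Suc j) x y = ((v - v_inv) *s ?z + ?y) + v_inv *s ?z + v_inv *s (v *s ?r)"
    unfolding kl
    by (simp only: distrib_left scale_mult_right t_mult_up[OF assms] t_mult_down[OF assms] Suc.IH)
  also have "\<dots> = v *s (?z + v_inv *s ?y + v_inv *s ?r)"
    by (simp add: scale_right_distrib scale_left_diff_distrib v_mult_v_inv del: lalt.simps)
  finally show ?case
    unfolding kl .
qed

lemma kl_zero: "gen_pair x y \<Longrightarrow> kl 0 x y = t x + v_inv *s 1"
  using gen_pair_closed[of x y] by (simp add: kl_def)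

lemma kl_zero_mult_same:
  assumes "gen_pair x y"
  shows "kl 0 x y * kl j x y = (v + v_inv) *s kl j x y"
  using t_mult_kl_below[OF assms, of "Suc j"]
  by (simp add: kl_zero[OF assms] kl_below_def distrib_right scale_mult_left scale_left_distrib)

text \<open>In the decomposition of \<open>kl j y x\<close>, multiplication by \<open>t x\<close>
  lengthens the two leading terms, while the block \<open>?r\<close> is an eigenvector with
  eigenvalue \<open>v\<close>. This cancels its factor \<open>v_inv\<close> and leaves one copy of
  \<open>?r\<close> besides the longer basis element.\<close>

lemma kl_zero_mult_other:
  assumes "gen_pair x y"
  shows "kl 0 x y * kl j y x = kl (Suc j) x y + kl_below j x y"
proof -
  let ?r = "kl_below j x y"
  let ?u = "t (lalt W (Suc j) y x)" and ?y = "t (lalt W j y x)" and ?z = "t (lalt W (Suc j) x y)"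
  have ball: "ball j = ?y + ?r"
    by (rule ball_split[OF assms])
  have ball': "ball (Suc j) = ?u + (?z + v_inv *s (?y + ?r))"
    using ball_split[OF assms, of "Suc j"] ball by (simp add: kl_below_def kl_def del: lalt.simps)
  have kl: "kl j y x = ?u + v_inv *s ?y + v_inv *s ?r"
    by (simp add: kl_def ball scale_right_distrib add.assoc del: lalt.simps)
  have "t x * kl j y x = t (lalt W (Suc (Suc j)) x y) + v_inv *s ?z + v_inv *s (v *s ?r)"
    unfolding kl
    by (simp only: distrib_left scale_mult_right t_mult_up[OF assms] t_mult_kl_below[OF assms])
  also have "v_inv *s (v *s ?r) = ?r"
    by (rule v_scale_v_inv)
  finally show ?thesis
    unfolding kl_zero[OF assms] kl_def[of "Suc j"] ball'
    by (simp add: kl distrib_right scale_mult_left scale_right_distrib add_ac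
        del: lalt.simps)
qed

lemma \<iota>_kl_zero:
  assumes "gen_pair x y"
  shows "\<iota> (kl 0 x y) = kl 0 x y"
proof -
  note cl = gen_pair_closed[OF assms]
  have "t x * t x = (v - v_inv) *s t x + 1"
    using t_mult_down[OF assms, of 0] cl by (simp add: t_one)
  \<comment> \<open>The quadratic relation exhibits the inverse of \<open>t x\<close>, and this
    inverse is the image of \<open>t x\<close> under the involution because \<open>x\<close> is its
    own inverse.\<close>
  then have tx: "t x * (t x - (v - v_inv) *s 1) = 1"
    by (simp add: right_diff_distrib scale_mult_right)
  have "\<iota> (t x) * t x = 1"
    using \<iota>_basis[of x] cl gen_pair_inv[OF assms] by simp
  then have "\<iota> (t x) * (t x * (t x - (v - v_inv) *s 1)) = t x - (v - v_inv) *s 1"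
    by (simp flip: mult.assoc)
  then have "\<iota> (t x) = t x - (v - v_inv) *s 1"
    by (simp only: tx mult_1_right)
  then show ?thesis
    by (simp add: kl_zero[OF assms] \<iota>_add \<iota>_scale \<iota>_one bar_v_inv scale_left_diff_distrib)
qed

text \<open>Solving \<open>kl_zero_mult_other\<close> for its longest term expresses
  \<open>kl j x y\<close> by products and differences of elements already known to be
  invariant.\<close>

lemma \<iota>_kl: "gen_pair x y \<Longrightarrow> \<iota> (kl j x y) = kl j x y"
proof (induction j arbitrary: x y rule: less_induct)
  case (less j)
  note sw = gen_pair_swap[OF less.prems]
  show ?case
  proof (cases j)
    case 0
    then show ?thesis using \<iota>_kl_zero[OF less.prems] by simp
  next
    case (Suc i)
    have below: "\<iota> (kl_below i x y) = kl_below i x y"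
      using less.IH[of "i - 1", OF _ less.prems] Suc
      by (cases i) (auto simp: kl_below_def \<iota>_zero)
    have "kl j x y = kl 0 x y * kl i y x - kl_below i x y"
      using kl_zero_mult_other[OF less.prems, of i] Suc by simp
    then show ?thesis
      using \<iota>_kl_zero[OF less.prems] less.IH[OF _ sw, of i] Suc below
      by (simp add: \<iota>_diff \<iota>_mult)
  qed
qed

section \<open>Uniqueness of the Kazhdan-Lusztig basis elements\<close>

abbreviation len :: "'w \<Rightarrow> nat" where
  "len \<equiv> word_length W {s1, s2}"

lemma t_lalt_filtration: "gen_pair x y \<Longrightarrow> j < n \<Longrightarrow> t (lalt W j x y) \<in> filtration n"
  by (rule filtration_basis) (simp_all only: lalt_closed word_length_lalt)

lemma ball_filtration: "ball j \<in> filtration (Suc j)"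
proof (induction j)
  case 0
  then show ?case
    using t_lalt_filtration[of s1 s2 0 1] by (simp add: t_one)
next
  case (Suc j)
  then have "ball j \<in> filtration (Suc (Suc j))"
    using filtration_mono[of "Suc j" "Suc (Suc j)"] by auto
  then show ?case
    using t_lalt_filtration[of s1 s2 "Suc j"] t_lalt_filtration[of s2 s1 "Suc j"]
    by (simp add: filtration_add filtration_scale del: lalt.simps)
qed

lemma v_inv_ball_negative: "v_inv *s ball j \<in> negative_span"
proof (induction j)
  case 0
  then show ?case
    using negative_span_basis[OF negative_laurent_v_inv, of \<one>] by (simp add: t_one)
next
  case (Suc j)
  have "v_inv *s t (lalt W (Suc j) x y) \<in> negative_span" if "gen_pair x y" for x y
    using negative_span_basis[OF negative_laurent_v_inv] lalt_closed[OF that] by blast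
  then show ?case
    using negative_span_scale[OF negative_laurent_v_inv Suc]
    by (simp add: scale_right_distrib negative_span_add del: lalt.simps scale_scale)
qed

text \<open>\<open>t w\<close> is an invariant element minus shorter terms, so only shorter terms
  change. The hypothesis \<open>stable\<close> is what the induction in
  \<open>\<iota>_filtration\<close> supplies for smaller layers.\<close>

lemma \<iota>_t_diff_filtration:
  assumes stable: "\<And>h. h \<in> filtration n \<Longrightarrow> \<iota> h \<in> filtration n"
    and "w \<in> carrier W" "len w = n"
  shows "\<iota> (t w) - t w \<in> filtration n"
proof -
  obtain j x y where w: "gen_pair x y" "w = lalt W j x y"
    using carrier_eq_lalt[OF assms(2)] by blast
  then have j: "j = n"
    using assms(3) word_length_lalt[OF w(1)] by simp
  show ?thesis
  proof (cases n)
    case 0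
    then show ?thesis
      using w j by (simp add: t_one \<iota>_one filtration_def span_zero)
  next
    case (Suc m)
    have tw: "t w = kl m x y - v_inv *s ball m"
      using w j Suc by (simp add: kl_def)
    have "\<iota> (t w) - t w = v_inv *s ball m - v *s \<iota> (ball m)"
      by (simp add: tw \<iota>_diff \<iota>_scale bar_v_inv \<iota>_kl[OF w(1)])
    moreover have "ball m \<in> filtration n"
      using ball_filtration Suc by simp
    ultimately show ?thesis
      using stable by (simp add: filtration_diff filtration_scale)
  qed
qed

lemma \<iota>_filtration: "h \<in> filtration n \<Longrightarrow> \<iota> h \<in> filtration n"
proof (induction n arbitrary: h rule: less_induct)
  case (less n)
  show ?case
    using less.prems
  proof (induction rule: filtration_induct)
    case zero
    then show ?case
      by (simp add: \<iota>_zero filtration_def span_zero)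
  next
    case (step a w g)
    have "\<iota> (t w) - t w \<in> filtration (len w)"
      using less.IH[OF step(2)] step(1) by (rule \<iota>_t_diff_filtration) simp_all
    then have "\<iota> (t w) - t w \<in> filtration n"
      using filtration_mono[of "len w" n] step(2) by auto
    then have "\<iota> (t w) \<in> filtration n"
      using filtration_add[of "\<iota> (t w) - t w" n "t w"] filtration_basis[of w n] step by simp
    then show ?case
      using step by (simp add: \<iota>_add \<iota>_scale filtration_add filtration_scale)
  qed
qed

text \<open>Modulo shorter elements the involution fixes every \<open>t u\<close>, so on the longest
  layer it acts on the scalars alone.\<close>

lemma coef_\<iota>_top:
  assumes "h \<in> filtration (Suc n)" "w \<in> carrier W" "len w = n"
  shows "coef w (\<iota> h) = bar (coef w h)"
  using assms(1)
proof (induction rule: filtration_induct)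
  case zero
  then show ?case
    by (simp add: \<iota>_zero coef_zero bar_zero)
next
  case (step a u g)
  have "\<iota> (t u) - t u \<in> filtration (len u)"
    using \<iota>_t_diff_filtration[OF \<iota>_filtration step(1) refl] .
  then have "\<iota> (t u) - t u \<in> filtration n"
    using step(2) filtration_mono[of "len u" n] by auto
  then have "coef w (\<iota> (t u)) = coef w (t u)"
    using coef_filtration[of "\<iota> (t u) - t u" n w] assms(2,3) by (simp add: coef_diff)
  then show ?case
    using step assms(2)
    by (simp add: \<iota>_add \<iota>_scale coef_add coef_scale bar_add coef_basis bar_zero)
qed

text \<open>The coefficients on the longest layer are negative and fixed by \<open>bar\<close>,
  hence zero. So \<open>h\<close> drops to the next layer, and the descent ends at layer 0.\<close>

lemma negative_invariant_imp_zero: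
  "h \<in> filtration n \<Longrightarrow> h \<in> negative_span \<Longrightarrow> \<iota> h = h \<Longrightarrow> h = 0"
proof (induction n)
  case 0
  then show ?case
    by (simp add: filtration_zero)
next
  case (Suc n)
  have "coef w h = 0" if w: "w \<in> carrier W" "n \<le> len w" for w
  proof (cases "len w = n")
    case True
    then have "bar (coef w h) = coef w h"
      using coef_\<iota>_top[OF Suc.prems(1) w(1)] Suc.prems(3) by simp
    then show ?thesis
      using negative_laurent_bar_fixed_imp_zero Suc.prems(2) w(1) unfolding negative_span_def by blast
  next
    case False
    then show ?thesis
      using coef_filtration[OF Suc.prems(1) w(1)] w(2) by simp
  qed
  then have "h \<in> filtration n"
    by (rule filtrationI)
  then show ?case
    using Suc.IH Suc.prems by blast
qed

text \<open>Both sides are invariant and have the same leading term, which cancels in the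
  difference. What remains has coefficients in \<open>negative_laurent\<close>.\<close>

lemma c_eq_kl:
  assumes "gen_pair x y"
  shows "c (lalt W (Suc j) x y) = kl j x y"
proof -
  let ?w = "lalt W (Suc j) x y"
  have w: "?w \<in> carrier W" "len ?w = Suc j"
    by (rule lalt_closed[OF assms] word_length_lalt[OF assms])+
  let ?A = "{u \<in> carrier W. bruhat_less W {s1, s2} u ?w}"
  obtain p where p: "\<And>u. p u \<in> negative_laurent" "c ?w = t ?w + (\<Sum>u\<in>?A. p u *s t u)"
    using c_unitriangular[OF w(1)] by blast
  have A: "u \<in> carrier W \<and> len u < Suc j" if "u \<in> ?A" for u
    using that bruhat_less_imp_word_length_less[of W "{s1, s2}" u ?w] w(2) by auto
  have diff: "c ?w - kl j x y = (\<Sum>u\<in>?A. p u *s t u) - v_inv *s ball j"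
    unfolding kl_def p(2) by (simp del: lalt.simps)
  have "(\<Sum>u\<in>?A. p u *s t u) \<in> filtration (Suc j)"
    using A by (intro filtration_sum filtration_scale) (simp add: filtration_basis)
  then have "c ?w - kl j x y \<in> filtration (Suc j)"
    unfolding diff using ball_filtration by (intro filtration_diff filtration_scale)
  moreover have "c ?w - kl j x y \<in> negative_span"
    unfolding diff using p(1)
    by (intro negative_span_diff negative_span_sum v_inv_ball_negative)
      (simp add: negative_span_basis)
  moreover have "\<iota> (c ?w - kl j x y) = c ?w - kl j x y"
    by (simp only: \<iota>_diff c_invariant[OF w(1)] \<iota>_kl[OF assms])
  ultimately have "c ?w - kl j x y = 0"
    by (rule negative_invariant_imp_zero)
  then show ?thesis by simp
qed

end
section \<open>Products of basis elements\<close>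

lemma sum_odd_step_two_eq_zero:
  fixes f :: "int \<Rightarrow> 'a::ab_group_add"
  assumes odd: "\<And>n. f (- n) = - f n" and zero: "f 0 = 0"
  shows "(\<Sum>m<d. f (1 - int d + 2 * int m)) = 0"
proof (induction d rule: nat_less_induct)
  case (1 d)
  consider "d = 0" | "d = 1" | e where "d = Suc (Suc e)"
    by (metis One_nat_def not0_implies_Suc)
  then show ?case
  proof cases
    case 3
    \<comment> \<open>The indices run from \<open>1 - d\<close> to \<open>d - 1\<close>,
      symmetrically about zero; the outermost pair is stripped off and the rest is the case
      \<open>e\<close>.\<close>
    have "(\<Sum>m<d. f (1 - int d + 2 * int m)) =
        f (- (int e + 1)) + ((\<Sum>m<e. f (1 - int e + 2 * int m)) + f (int e + 1))"
      unfolding 3 by (subst sum.lessThan_Suc_shift) (simp add: algebra_simps)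
    also have "\<dots> = f (- (int e + 1)) + f (int e + 1)"
      using 1 3 by simp
    also have "\<dots> = 0"
      by (simp only: odd) simp
    finally show ?thesis .
  qed (simp_all add: zero)
qed

text \<open>The first \<open>i - k\<close> indices on the left are symmetric about zero and cancel;
  the last \<open>k\<close> terms remain.\<close>

lemma sum_odd_step_two_swap:
  fixes f :: "int \<Rightarrow> 'a::ab_group_add"
  assumes "\<And>n. f (- n) = - f n" "f 0 = 0" and "k \<le> i"
  shows "(\<Sum>m<i. f (int k - int i + 1 + 2 * int m)) = (\<Sum>m<k. f (int i - int k + 1 + 2 * int m))"
proof -
  obtain d where d: "i = d + k"
    using assms(3) le_Suc_ex by (metis add.commute)
  have "(\<Sum>m<d + k. f (1 - int d + 2 * int m)) =
      (\<Sum>m<d. f (1 - int d + 2 * int m)) + (\<Sum>m<k. f (1 - int d + 2 * int (d + m)))"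
    by (induction k) (simp_all add: add.assoc)
  also have "\<dots> = (\<Sum>m<k. f (int d + 1 + 2 * int m))"
    by (simp only: sum_odd_step_two_eq_zero[OF assms(1,2)]) (simp add: algebra_simps)
  finally show ?thesis
    unfolding d by (simp add: algebra_simps)
qed

text \<open>This is the source of the coefficients 1, 2, ..., 2, 1.\<close>

lemma sum_neighbours:
  fixes f :: "nat \<Rightarrow> 'a::ring_1"
  assumes "n > 0"
  shows "(\<Sum>m<n. f m + f (Suc m)) = f 0 + (\<Sum>m\<in>{1..<n}. 2 * f m) + f n"
  using assms
proof (induction n rule: nat_induct_non_zero)
  case 1
  then show ?case by simp
next
  case (Suc n)
  then show ?case
    by (simp add: sum.atLeastLessThan_Suc mult_2 algebra_simps)
qed

text \<open>Multiplication by \<open>g\<close> shifts the row of indices by one in both directions,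
  and subtracting the earlier row removes the overlap. The parity condition in \<open>mult\<close>
  reflects that \<open>g\<close> will alternate between the two generators; every index in the row
  meets it.\<close>

lemma chebyshev_recurrence_sum:
  fixes P :: "nat \<Rightarrow> 'a::ring" and L :: "int \<Rightarrow> 'a"
  assumes P0: "P 0 = 0" and P1: "P 1 = L k"
    and step: "\<And>i. P (Suc (Suc i)) = g i * P (Suc i) - P i"
    and mult: "\<And>i n. even (n + k + int i) \<Longrightarrow> g i * L n = L (n - 1) + L (n + 1)"
  shows "P i = (\<Sum>m<i. L (k - int i + 1 + 2 * int m))"
proof (induction i rule: nat_less_induct)
  case (1 i)
  consider "i = 0" | "i = 1" | e where "i = Suc (Suc e)"
    by (metis One_nat_def not0_implies_Suc)
  then show ?case
  proof cases
    case 3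
    have e1: "P (Suc e) = (\<Sum>m<Suc e. L (k - int e + 2 * int m))"
      using 1 3 by (simp add: algebra_simps)
    have e0: "P e = (\<Sum>m<e. L (k - int e + 1 + 2 * int m))"
      using 1 3 by simp
    have "g e * P (Suc e) =
        (\<Sum>m<Suc e. L (k - int e + 2 * int m - 1) + L (k - int e + 2 * int m + 1))"
      unfolding e1 sum_distrib_left by (intro sum.cong refl mult) simp
    \<comment> \<open>All but the last term of the row shifted upwards make up \<open>P e\<close>,
      which the recurrence then subtracts.\<close>
    also have "\<dots> = (\<Sum>m<Suc e. L (k - int e + 2 * int m - 1)) + (P e + L (k + int e + 1))"
      unfolding sum.distrib e0 by (simp add: algebra_simps)
    finally have "P i = (\<Sum>m<Suc e. L (k - int e + 2 * int m - 1)) + L (k + int e + 1)"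
      unfolding 3 step by simp
    then show ?thesis
      unfolding 3 sum.lessThan_Suc[of _ "Suc e"] by (simp add: algebra_simps)
  qed (simp_all add: P0 P1[simplified])
qed

section \<open>The odd extension under multiplication by a generator\<close>

context dihedral_hecke
begin

text \<open>For positive \<open>n\<close> this is the first letter of
  \<open>alt W (nat n) a b\<close>. Since it depends on parity alone, it makes sense for all
  integers and is unchanged by negation of the index.\<close>

definition letter :: "'w \<Rightarrow> 'w \<Rightarrow> int \<Rightarrow> 'w" where
  "letter a b n = (if even n then a else b)"

text \<open>The odd extension of $j \mapsto c_{\langle j, a, b]}$ makes
  $c_s c_{\langle j, a, b]} = c_{\langle j + 1, a, b]} + c_{\langle j - 1, a, b]}$ hold without exception
  at $j = 0$ and $j = 1$. In particular its value at 0 is 0 and not $c_1$.\<close>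

definition signed_c :: "'w \<Rightarrow> 'w \<Rightarrow> int \<Rightarrow> 'h" where
  "signed_c a b n =
    (if n > 0 then c (alt W (nat n) a b) else if n < 0 then - c (alt W (nat (- n)) a b) else 0)"

lemma signed_c_minus: "signed_c a b (- n) = - signed_c a b n"
  by (simp add: signed_c_def)

lemma signed_c_zero: "signed_c a b 0 = 0"
  by (simp add: signed_c_def)

lemma signed_c_of_nat: "j > 0 \<Longrightarrow> signed_c a b (int j) = c (alt W j a b)"
  by (simp add: signed_c_def)

lemma gen_pair_letter:
  "gen_pair a b \<Longrightarrow> gen_pair (letter a b n) (letter a b (n + 1))"
  by (auto simp: letter_def)

lemma letter_cong: "even (m + n) \<Longrightarrow> letter a b m = letter a b n"
  by (simp add: letter_def)

lemma c_letter:
  assumes "gen_pair a b"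
  shows "c (letter a b n) = kl 0 (letter a b n) (letter a b (n + 1))"
  using c_eq_kl[OF gen_pair_letter[OF assms], of 0 n] gen_pair_closed[OF gen_pair_letter[OF assms]]
  by simp

lemma signed_c_eq_kl_below:
  assumes "gen_pair a b"
  shows "signed_c a b (int j) = kl_below j (letter a b (int j)) (letter a b (int j + 1))"
proof (cases j)
  case 0
  then show ?thesis
    by (simp add: kl_below_def signed_c_zero)
next
  case (Suc i)
  have "alt W j a b = lalt W j (letter a b (int j)) (letter a b (int j + 1))"
    using alt_eq_lalt[OF assms, of j] by (simp add: letter_def)
  then show ?thesis
    using c_eq_kl[OF gen_pair_letter[OF assms], of i "int j"] Suc
    by (simp add: signed_c_of_nat kl_below_def del: lalt.simps alt.simps of_nat_Suc)
qed

lemma c_letter_mult_same: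
  assumes "gen_pair a b"
  shows "c (letter a b n) * signed_c a b n = (v + v_inv) *s signed_c a b n"
proof -
  have nat: "c (letter a b (int j)) * signed_c a b (int j) = (v + v_inv) *s signed_c a b (int j)" for j
  proof (cases j)
    case 0
    then show ?thesis by (simp add: signed_c_zero)
  next
    case (Suc i)
    then show ?thesis
      using kl_zero_mult_same[OF gen_pair_letter[OF assms, of "int j"], of i]
      unfolding c_letter[OF assms] signed_c_eq_kl_below[OF assms] by (simp add: kl_below_def)
  qed
  show ?thesis
  proof (cases "n \<ge> 0")
    case True
    then show ?thesis using nat[of "nat n"] by simp
  next
    case False
    then show ?thesis
      using nat[of "nat (- n)"] signed_c_minus[of a b n] letter_cong[of n "- n"] by simp
  qed
qed

lemma c_letter_mult_next:
  assumes "gen_pair a b"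
  shows "c (letter a b (n + 1)) * signed_c a b n = signed_c a b (n - 1) + signed_c a b (n + 1)"
proof -
  have nat: "c (letter a b (int j + 1)) * signed_c a b (int j)
      = signed_c a b (int j - 1) + signed_c a b (int j + 1)" for j
  proof (cases j)
    case 0
    \<comment> \<open>At index 0 the left side is zero, and on the right the values at -1 and 1
      cancel.\<close>
    then show ?thesis
      using signed_c_minus[of a b 1] by (simp add: signed_c_zero)
  next
    case (Suc i)
    let ?x = "letter a b (int i)" and ?y = "letter a b (int i + 1)"
    have letters: "letter a b (int j) = ?y" "letter a b (int j + 1) = ?x"
      "letter a b (int j + 1 + 1) = ?y"
      by (simp_all add: letter_def Suc)
    have "signed_c a b (int j + 1) = kl (Suc i) ?x ?y"
      using signed_c_eq_kl_below[OF assms, of "Suc j"] letters Suc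
      by (simp add: kl_below_def add.commute)
    \<comment> \<open>For \<open>i = 0\<close> both sides are zero, which accounts for the missing
      lower term of a one-letter word.\<close>
    moreover have "signed_c a b (int j - 1) = kl_below i ?x ?y"
      using signed_c_eq_kl_below[OF assms, of i] Suc by simp
    moreover have "signed_c a b (int j) = kl i ?y ?x"
      using signed_c_eq_kl_below[OF assms, of j] letters Suc by (simp add: kl_below_def)
    ultimately show ?thesis
      using kl_zero_mult_other[OF gen_pair_letter[OF assms, of "int i"], of i]
        c_letter[OF assms, of "int j + 1"] letters
      by (simp add: add.commute)
  qed
  show ?thesis
  proof (cases "n \<ge> 0")
    case True
    then show ?thesis using nat[of "nat n"] by simp
  next
    case False
    \<comment> \<open>Negating the index exchanges its two neighbours and preserves the letter, so
      the negative case mirrors the positive one.\<close>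
    have "- n - 1 = - (n + 1)" "- n + 1 = - (n - 1)"
      by simp_all
    then have "signed_c a b (- n - 1) = - signed_c a b (n + 1)"
      "signed_c a b (- n + 1) = - signed_c a b (n - 1)"
      by (simp_all only: signed_c_minus)
    then show ?thesis
      using False nat[of "nat (- n)"] signed_c_minus[of a b n] letter_cong[of "n + 1" "- n + 1"]
      by (simp add: algebra_simps)
  qed
qed

lemma signed_c_recurrence:
  assumes "gen_pair a b"
  shows "signed_c a b (int (Suc (Suc i))) * h =
    c (letter a b (int i)) * (signed_c a b (int (Suc i)) * h) - signed_c a b (int i) * h"
proof -
  have "c (letter a b (int i)) * signed_c a b (int (Suc i))
      = signed_c a b (int i) + signed_c a b (int (Suc (Suc i)))"
    using c_letter_mult_next[OF assms, of "int (Suc i)"] letter_cong[of "int (Suc i) + 1" "int i"]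
    by (simp add: add.commute)
  then show ?thesis
    by (simp add: distrib_right flip: mult.assoc)
qed

text \<open>The factor of length one is \<open>letter a b (k + 1)\<close>, so the recurrence starts
  from the sum of the two neighbours of index \<open>k\<close>; this sum is taken as
  \<open>L k\<close>.\<close>

lemma signed_c_mult_other:
  assumes "gen_pair a b"
  shows "signed_c (letter a b k) (letter a b (k + 1)) (int i) * signed_c a b k =
    (\<Sum>m<i. signed_c a b (k - int i + 2 * int m) + signed_c a b (k - int i + 2 * int m + 2))"
proof -
  let ?s = "letter a b k" and ?t = "letter a b (k + 1)"
  define L where "L n = signed_c a b (n - 1) + signed_c a b (n + 1)" for n
  note st = gen_pair_letter[OF assms, of k]
  have letter: "letter ?s ?t n = letter a b (k + n)" for n
    by (simp add: letter_def)
  have "signed_c ?s ?t (int i) * signed_c a b k = (\<Sum>m<i. L (k - int i + 1 + 2 * int m))"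
  proof (rule chebyshev_recurrence_sum[where g = "\<lambda>i. c (letter ?s ?t (int i))"])
    show "signed_c ?s ?t (int 0) * signed_c a b k = 0"
      by (simp add: signed_c_zero)
    have "alt W 1 ?s ?t = ?t"
      using gen_pair_closed[OF st] by simp
    then show "signed_c ?s ?t (int 1) * signed_c a b k = L k"
      using c_letter_mult_next[OF assms, of k] unfolding L_def
      by (simp only: signed_c_of_nat zero_less_one)
  next
    fix i
    show "signed_c ?s ?t (int (Suc (Suc i))) * signed_c a b k =
        c (letter ?s ?t (int i)) * (signed_c ?s ?t (int (Suc i)) * signed_c a b k)
          - signed_c ?s ?t (int i) * signed_c a b k"
      by (rule signed_c_recurrence[OF st])
  next
    fix i :: nat and n :: int
    assume "even (n + k + int i)"
    \<comment> \<open>By parity the same generator fits both summands of \<open>L n\<close>, so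
      \<open>c_letter_mult_next\<close> applies to each.\<close>
    then have "letter ?s ?t (int i) = letter a b (n - 1 + 1)"
      "letter ?s ?t (int i) = letter a b (n + 1 + 1)"
      unfolding letter by (auto intro!: letter_cong simp: add_ac)
    then show "c (letter ?s ?t (int i)) * L n = L (n - 1) + L (n + 1)"
      using c_letter_mult_next[OF assms, of "n - 1"] c_letter_mult_next[OF assms, of "n + 1"]
      unfolding L_def by (simp add: distrib_left)
  qed
  then show ?thesis
    by (simp add: L_def algebra_simps)
qed

text \<open>Now the factor of length one is \<open>letter a b k\<close>, which acts on the value at
  \<open>k\<close> by the scalar \<open>v + v_inv\<close>. The recurrence carries this scalar
  along.\<close>

lemma signed_c_mult_same:
  assumes "gen_pair a b"
  shows "signed_c (letter a b (k + 1)) (letter a b k) (int i) * signed_c a b k =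
    (\<Sum>m<i. (v + v_inv) *s signed_c a b (k - int i + 1 + 2 * int m))"
proof -
  let ?s = "letter a b k" and ?t = "letter a b (k + 1)"
  note ts = gen_pair_swap[OF gen_pair_letter[OF assms, of k]]
  have letter: "letter ?t ?s n = letter a b (k + n + 1)" for n
    by (simp add: letter_def)
  show ?thesis
  proof (rule chebyshev_recurrence_sum[where g = "\<lambda>i. c (letter ?t ?s (int i))"
        and L = "\<lambda>n. (v + v_inv) *s signed_c a b n"])
    show "signed_c ?t ?s (int 0) * signed_c a b k = 0"
      by (simp add: signed_c_zero)
    have "alt W 1 ?t ?s = ?s"
      using gen_pair_closed[OF ts] by simp
    then show "signed_c ?t ?s (int 1) * signed_c a b k = (v + v_inv) *s signed_c a b k"
      using c_letter_mult_same[OF assms, of k]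
      by (simp only: signed_c_of_nat zero_less_one)
  next
    fix i
    show "signed_c ?t ?s (int (Suc (Suc i))) * signed_c a b k =
        c (letter ?t ?s (int i)) * (signed_c ?t ?s (int (Suc i)) * signed_c a b k)
          - signed_c ?t ?s (int i) * signed_c a b k"
      by (rule signed_c_recurrence[OF ts])
  next
    fix i :: nat and n :: int
    assume "even (n + k + int i)"
    then have "letter ?t ?s (int i) = letter a b (n + 1)"
      unfolding letter by (auto intro!: letter_cong simp: add_ac)
    then show "c (letter ?t ?s (int i)) * ((v + v_inv) *s signed_c a b n) =
        (v + v_inv) *s signed_c a b (n - 1) + (v + v_inv) *s signed_c a b (n + 1)"
      using c_letter_mult_next[OF assms, of n]
      by (simp only: scale_mult_right scale_right_distrib)
  qed
qed

section \<open>The product formulas with positive indices\<close>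

lemma c_mult_other:
  assumes "gen_pair a b" and "k > 0" "i > 0"
  defines "s \<equiv> letter a b (int k)" and "t' \<equiv> letter a b (int k + 1)"
  shows "i < k \<Longrightarrow> c (alt W i s t') * c (alt W k a b) = c (alt W (k - i) a b)
      + (\<Sum>m\<in>{1..<i}. 2 * c (alt W (k - i + 2 * m) a b)) + c (alt W (k + i) a b)"
    and "i = k \<Longrightarrow> c (alt W i s t') * c (alt W k a b) =
      (\<Sum>m\<in>{1..<k}. 2 * c (alt W (2 * m) a b)) + c (alt W (2 * k) a b)"
    and "i > k \<Longrightarrow> c (alt W i s t') * c (alt W k a b) = c (alt W (i - k) a b)
      + (\<Sum>m\<in>{1..<k}. 2 * c (alt W (i - k + 2 * m) a b)) + c (alt W (i + k) a b)"
proof -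
  let ?K = "signed_c a b"
  define L where "L n = ?K (n - 1) + ?K (n + 1)" for n
  have lhs: "c (alt W i s t') * c (alt W k a b) = (\<Sum>m<i. L (int k - int i + 1 + 2 * int m))"
    using signed_c_mult_other[OF assms(1), of "int k" i] assms(2,3)
    by (simp add: signed_c_of_nat L_def s_def t'_def algebra_simps)
  have L_minus: "L (- n) = - L n" for n
  proof -
    have "- n - 1 = - (n + 1)" "- n + 1 = - (n - 1)"
      by simp_all
    then show ?thesis
      unfolding L_def by (simp only: signed_c_minus) simp
  qed
  have L_zero: "L 0 = 0"
    using signed_c_minus[of a b 1] by (simp add: L_def)
  \<comment> \<open>This is applied with \<open>d\<close> equal to \<open>k - i\<close>, 0 and
    \<open>i - k\<close>. The first term stays in signed form because it vanishes for
    \<open>d = 0\<close>, which is why the formula for \<open>i = k\<close> starts with coefficient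
    2.\<close>
  have sum: "(\<Sum>m<n. L (int d + 1 + 2 * int m)) =
      ?K (int d) + (\<Sum>m\<in>{1..<n}. 2 * c (alt W (d + 2 * m) a b)) + c (alt W (d + 2 * n) a b)"
    if "n > 0" for d n
  proof -
    have "(\<Sum>m<n. L (int d + 1 + 2 * int m)) =
        (\<Sum>m<n. ?K (int (d + 2 * m)) + ?K (int (d + 2 * Suc m)))"
      by (simp add: L_def algebra_simps)
    also have "\<dots> = ?K (int d) + (\<Sum>m\<in>{1..<n}. 2 * ?K (int (d + 2 * m))) + ?K (int (d + 2 * n))"
      using sum_neighbours[OF that, of "\<lambda>m. ?K (int (d + 2 * m))"] by simp
    also have "(\<Sum>m\<in>{1..<n}. 2 * ?K (int (d + 2 * m))) =
        (\<Sum>m\<in>{1..<n}. 2 * c (alt W (d + 2 * m) a b))"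
      by (intro sum.cong refl arg_cong[of _ _ "(*) 2"] signed_c_of_nat) simp
    also have "?K (int (d + 2 * n)) = c (alt W (d + 2 * n) a b)"
      using that by (intro signed_c_of_nat) simp
    finally show ?thesis .
  qed
  {
    assume "i < k"
    moreover from this have "k - i + 2 * i = k + i"
      by simp
    ultimately show "c (alt W i s t') * c (alt W k a b) = c (alt W (k - i) a b)
      + (\<Sum>m\<in>{1..<i}. 2 * c (alt W (k - i + 2 * m) a b)) + c (alt W (k + i) a b)"
      using sum[OF assms(3), of "k - i"] signed_c_of_nat[of "k - i" a b] lhs
      by (simp add: add.commute[of k i])
  next
    assume "i = k"
    then show "c (alt W i s t') * c (alt W k a b) =
      (\<Sum>m\<in>{1..<k}. 2 * c (alt W (2 * m) a b)) + c (alt W (2 * k) a b)"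
      using sum[OF assms(2), of 0] lhs by (simp add: signed_c_zero)
  next
    assume "i > k"
    moreover from this have "i - k + 2 * k = i + k"
      by simp
    \<comment> \<open>Since \<open>L\<close> is odd, opposite indices cancel and a sum of
      \<open>k\<close> terms with positive indices is left.\<close>
    moreover have "(\<Sum>m<i. L (int k - int i + 1 + 2 * int m)) =
        (\<Sum>m<k. L (int i - int k + 1 + 2 * int m))"
      using \<open>i > k\<close> sum_odd_step_two_swap[of L, OF L_minus L_zero] by simp
    ultimately show "c (alt W i s t') * c (alt W k a b) = c (alt W (i - k) a b)
      + (\<Sum>m\<in>{1..<k}. 2 * c (alt W (i - k + 2 * m) a b)) + c (alt W (i + k) a b)"
      using sum[OF assms(2), of "i - k"] signed_c_of_nat[of "i - k" a b] lhs
      by (simp add: add.commute[of i k])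
  }
qed

lemma c_mult_same:
  assumes "gen_pair a b" and "k > 0" "i > 0"
  defines "s \<equiv> letter a b (int k)" and "t' \<equiv> letter a b (int k + 1)"
  shows "i \<le> k \<Longrightarrow> c (alt W i t' s) * c (alt W k a b) =
      (\<Sum>m\<in>{0..<i}. (v + v_inv) *s c (alt W (k - i + 1 + 2 * m) a b))"
    and "i \<ge> k \<Longrightarrow> c (alt W i t' s) * c (alt W k a b) =
      (\<Sum>m\<in>{0..<k}. (v + v_inv) *s c (alt W (i - k + 1 + 2 * m) a b))"
proof -
  define L where "L n = (v + v_inv) *s signed_c a b n" for n
  have lhs: "c (alt W i t' s) * c (alt W k a b) = (\<Sum>m<i. L (int k - int i + 1 + 2 * int m))"
    using signed_c_mult_same[OF assms(1), of "int k" i] assms(2,3)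
    by (simp add: signed_c_of_nat L_def s_def t'_def)
  have sum: "(\<Sum>m<n. L (int d + 1 + 2 * int m)) =
      (\<Sum>m\<in>{0..<n}. (v + v_inv) *s c (alt W (d + 1 + 2 * m) a b))" for d n
  proof (rule sum.cong)
    fix m
    have "signed_c a b (int d + 1 + 2 * int m) = c (alt W (d + 1 + 2 * m) a b)"
      using signed_c_of_nat[of "d + 1 + 2 * m" a b] by (simp add: add_ac del: alt.simps)
    then show "L (int d + 1 + 2 * int m) = (v + v_inv) *s c (alt W (d + 1 + 2 * m) a b)"
      by (simp only: L_def)
  qed (simp add: lessThan_atLeast0)
  {
    assume "i \<le> k"
    then show "c (alt W i t' s) * c (alt W k a b) =
        (\<Sum>m\<in>{0..<i}. (v + v_inv) *s c (alt W (k - i + 1 + 2 * m) a b))"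
      using sum[of "k - i" i] lhs by simp
  next
    assume "i \<ge> k"
    moreover have "(\<Sum>m<i. L (int k - int i + 1 + 2 * int m)) =
        (\<Sum>m<k. L (int i - int k + 1 + 2 * int m))"
      using \<open>i \<ge> k\<close> by (rule sum_odd_step_two_swap[of L, rotated 2])
        (simp_all add: L_def signed_c_minus signed_c_zero)
    ultimately show "c (alt W i t' s) * c (alt W k a b) =
        (\<Sum>m\<in>{0..<k}. (v + v_inv) *s c (alt W (i - k + 1 + 2 * m) a b))"
      using sum[of "i - k" k] lhs by simp
  }
qed

end

theorem proposition4p4:
  fixes W :: "('w, 'm) monoid_scheme" and s1 s2 :: 'w
    and scale :: "laurent \<Rightarrow> 'h::ring_1 \<Rightarrow> 'h"
    and T :: "'w \<Rightarrow> 'h" and \<iota> :: "'h \<Rightarrow> 'h" and c :: "'w \<Rightarrow> 'h"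
    and k i :: nat
  assumes "infinite_dihedral W s1 s2"
    and "kazhdan_lusztig_basis scale W {s1, s2} T \<iota> c"
    and "k > 0" and "i > 0"
  shows "\<forall>(a, b) \<in> {(s1, s2), (s2, s1)}.
    let C = (\<lambda>j. c (alt W j a b));
        s = (if even k then a else b);
        t = (if even k then b else a)
    in (i < k \<longrightarrow> c (alt W i s t) * C k
          = C (k - i) + (\<Sum>m\<in>{1..<i}. 2 * C (k - i + 2 * m)) + C (k + i))
     \<and> (i = k \<longrightarrow> c (alt W i s t) * C k
          = (\<Sum>m\<in>{1..<k}. 2 * C (2 * m)) + C (2 * k))
     \<and> (i > k \<longrightarrow> c (alt W i s t) * C k
          = C (i - k) + (\<Sum>m\<in>{1..<k}. 2 * C (i - k + 2 * m)) + C (i + k))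
     \<and> (i \<le> k \<longrightarrow> c (alt W i t s) * C k
          = (\<Sum>m\<in>{0..<i}. scale (v + v_inv) (C (k - i + 1 + 2 * m))))
     \<and> (i \<ge> k \<longrightarrow> c (alt W i t s) * C k
          = (\<Sum>m\<in>{0..<k}. scale (v + v_inv) (C (i - k + 1 + 2 * m))))"
proof -
  interpret dihedral_hecke scale W s1 s2 T \<iota> c
    using assms(1,2) by (rule dihedral_hecke.intro)
  have letters: "letter a b (int k) = (if even k then a else b)"
    "letter a b (int k + 1) = (if even k then b else a)" for a b
    by (simp_all add: letter_def)
  note products =
    c_mult_other[OF _ assms(3,4), unfolded letters] c_mult_same[OF _ assms(3,4), unfolded letters]
  show ?thesis
    unfolding Let_def case_prod_beta
    by (intro ballI conjI impI; rule products; (assumption | simp only: prod.collapse))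
qed

end
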